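(* Let $V$ be a real vector space, $X\subseteq V$, and $L:=Co(V,X)$. The following are equivalent: (i) $L$ is topologically scattered (as a subspace of $\mathbf{2}^X$ with the product topology); (ii) $L$ is order-scattered; (iii) the join-semilattice $S$ of compact elements of $L$ is order-scattered and has no join-subsemilattice isomorphic to $\mathcal{P}^{<\omega}(\mathbb{N})$; (iv) $X$ is contained in a finite union of lines of $V$, and for each such line $\ell$, equipped with an orientation, the linear order induced on the points of $X\cap \ell$ is order-scattered.
   Context: $Co(V,X)$ is the family of sets $C\cap X$ with $C$ a convex subset of $V$, ordered by inclusion; it is the lattice of closed sets of the closure $Y\mapsto \mathrm{conv}(Y)\cap X$ on $X$, and its compact elements are the sets $\mathrm{conv}(F)\cap X$ with $F\subseteq X$ finite. $\mathcal{P}^{<\omega}(\mathbb{N})$ is the join-semilattice (under union) of finite subsets of $\mathbb{N}$. A poset is order-scattered if it contains no copy of the chain $\mathbb{Q}$. A topological space is (topologically) scattered if every non-empty subset has an isolated point (in the induced topology); $Co(V,X)$ is viewed as a subset of $\mathbf{2}^X\cong\mathcal{P}(X)$ with the product of discrete two-point spaces.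
   Formalization: The formal theorem assumes V is not the zero space: for V = {0} and X = {0} conditions (i)–(iii) hold, but V contains no lines, so (iv) fails. *)

theory Defs
  imports "HOL-Analysis.Analysis"
begin

definition Co :: "'v::real_vector set \<Rightarrow> 'v set set" where
  "Co X = {C \<inter> X | C. convex C}"

definition cantor_cube :: "'i set \<Rightarrow> ('i \<Rightarrow> bool) topology" where
  "cantor_cube X = product_topology (\<lambda>_. discrete_topology (UNIV :: bool set)) X"

definition char_fun :: "'i set \<Rightarrow> 'i set \<Rightarrow> ('i \<Rightarrow> bool)" where
  "char_fun X A = (\<lambda>x\<in>X. x \<in> A)"

definition top_scattered :: "'a topology \<Rightarrow> bool" where
  "top_scattered T \<longleftrightarrow>
     (\<forall>Y. Y \<subseteq> topspace T \<and> Y \<noteq> {} \<longrightarrow> (\<exists>x\<in>Y. \<exists>U. openin T U \<and> U \<inter> Y = {x}))"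

definition order_scattered_sets :: "'a set set \<Rightarrow> bool" where
  "order_scattered_sets P \<longleftrightarrow>
     \<not> (\<exists>f :: rat \<Rightarrow> 'a set. range f \<subseteq> P \<and> (\<forall>p q. p < q \<longrightarrow> f p \<subset> f q))"

definition order_scattered_real :: "real set \<Rightarrow> bool" where
  "order_scattered_real T \<longleftrightarrow>
     \<not> (\<exists>f :: rat \<Rightarrow> real. range f \<subseteq> T \<and> (\<forall>p q. p < q \<longrightarrow> f p < f q))"

definition is_lub_in :: "'a set set \<Rightarrow> 'a set \<Rightarrow> 'a set \<Rightarrow> 'a set \<Rightarrow> bool" where
  "is_lub_in P a b c \<longleftrightarrow> c \<in> P \<and> a \<subseteq> c \<and> b \<subseteq> c \<and> (\<forall>d\<in>P. a \<subseteq> d \<and> b \<subseteq> d \<longrightarrow> c \<subseteq> d)"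

text \<open>Supremum of a family D in a closure system L (closed under intersections).\<close>
definition sup_in :: "'a set set \<Rightarrow> 'a set set \<Rightarrow> 'a set" where
  "sup_in L D = \<Inter> {c \<in> L. \<Union> D \<subseteq> c}"

definition directed_sets :: "'a set set \<Rightarrow> bool" where
  "directed_sets D \<longleftrightarrow> D \<noteq> {} \<and> (\<forall>a\<in>D. \<forall>b\<in>D. \<exists>c\<in>D. a \<subseteq> c \<and> b \<subseteq> c)"

definition compact_elements :: "'a set set \<Rightarrow> 'a set set" where
  "compact_elements L = {a \<in> L. \<forall>D. D \<subseteq> L \<and> directed_sets D \<and> a \<subseteq> sup_in L D
                                   \<longrightarrow> (\<exists>d\<in>D. a \<subseteq> d)}"

definition has_fin_powerset_subsemilattice :: "'a set set \<Rightarrow> bool" where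
  "has_fin_powerset_subsemilattice S \<longleftrightarrow>
     (\<exists>f :: nat set \<Rightarrow> 'a set.
        inj_on f {A. finite A} \<and> f ` {A. finite A} \<subseteq> S \<and>
        (\<forall>A B. finite A \<and> finite B \<longrightarrow> is_lub_in S (f A) (f B) (f (A \<union> B))))"

definition line :: "'v::real_vector \<Rightarrow> 'v \<Rightarrow> 'v set" where
  "line a d = {a + t *\<^sub>R d | t. True}"

end

theory Submission
  imports Defs "HOL-Library.Ramsey"
begin

text \<open>
  The closed sets of \<open>Co X\<close> are determined by their traces on the lines covering \<open>X\<close>. Fixing a point
  \<open>b\<close> of such a trace turns it into a pair of down-sets, one on each of the two rays from \<open>b\<close>, and a
  non-empty family of down-sets of a scattered chain has an isolated member. Treating the finitely many
  lines one after the other gives topological scatteredness. A copy of the rationals in \<open>Co X\<close> yields a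
  family without isolated points, and a copy of the finite subsets of \<open>\<nat>\<close> among the compact elements
  makes the full power set of \<open>\<nat>\<close>, hence a copy of the rationals, appear in \<open>Co X\<close>. Finally, if \<open>X\<close> is
  not covered by finitely many lines, a maximal subset without three collinear points is infinite; by
  Ramsey's theorem it contains an infinite set that is linearly independent or projects to a cup or cap
  in the plane. Such a set is convexly independent, so its finite subsets generate a copy of the finite
  subsets of \<open>\<nat>\<close>.
\<close>

section \<open>Copies of the rationals and isolated points\<close>

text \<open>The rationals are placed one at a time along an enumeration, each new one between its
  nearest neighbours already placed, where \<open>dense\<close> supplies a value in
  \<open>T\<close>. The points \<open>a\<close> and \<open>b\<close> act only as outer bounds and
  may lie outside \<open>T\<close>.\<close>

lemma rat_embedding:
  fixes R :: "'a \<Rightarrow> 'a \<Rightarrow> bool"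
  assumes trans: "\<And>x y z. R x y \<Longrightarrow> R y z \<Longrightarrow> R x z"
    and dense: "\<And>x y. R x y \<Longrightarrow> \<exists>z\<in>T. R x z \<and> R z y"
    and ab: "R a b"
  obtains f :: "rat \<Rightarrow> 'a" where "range f \<subseteq> T" "\<And>p q. p < q \<Longrightarrow> R (f p) (f q)"
proof -
  define S :: "nat \<Rightarrow> rat set" where "S n = from_nat ` {..<n}" for n
  define P :: "nat \<Rightarrow> (rat \<Rightarrow> 'a) \<Rightarrow> bool" where
    "P n g \<longleftrightarrow> (\<forall>p\<in>S n. g p \<in> T \<and> R a (g p) \<and> R (g p) b) \<and>
      (\<forall>p\<in>S n. \<forall>q\<in>S n. p < q \<longrightarrow> R (g p) (g q))" for n g
  have S_Suc: "S (Suc n) = insert (from_nat n) (S n)" for n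
    by (simp add: S_def lessThan_Suc)
  have finS: "finite (S n)" for n
    by (simp add: S_def)
  have step: "\<exists>g'. P (Suc n) g' \<and> (\<forall>p\<in>S n. g' p = g p)" if g: "P n g" for n g
  proof (cases "from_nat n \<in> S n")
    \<comment> \<open>\<open>from_nat\<close> may repeat a value, in which case the next rational
      has been placed already.\<close>
    case True
    then show ?thesis
      using g by (intro exI[of _ g]) (simp add: P_def S_Suc insert_absorb)
  next
    case False
    define q :: rat where "q = from_nat n"
    \<comment> \<open>\<open>lo\<close> and \<open>hi\<close> are the images of the neighbours of
      \<open>q\<close> among the rationals placed so far; \<open>a\<close> and \<open>b\<close>
      stand in for a missing neighbour.\<close>
    define lo where "lo = (if {p\<in>S n. p < q} = {} then a else g (Max {p\<in>S n. p < q}))"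
    define hi where "hi = (if {p\<in>S n. q < p} = {} then b else g (Min {p\<in>S n. q < p}))"
    have fin: "finite {p\<in>S n. p < q}" "finite {p\<in>S n. q < p}"
      using finS by auto
    have lo_mem: "Max {p\<in>S n. p < q} \<in> {p\<in>S n. p < q}" if "{p\<in>S n. p < q} \<noteq> {}"
      using Max_in[OF fin(1) that] .
    have hi_mem: "Min {p\<in>S n. q < p} \<in> {p\<in>S n. q < p}" if "{p\<in>S n. q < p} \<noteq> {}"
      using Min_in[OF fin(2) that] .
    have lo_hi: "R lo hi"
    proof (cases "{p\<in>S n. p < q} = {}"; cases "{p\<in>S n. q < p} = {}")
      assume ne: "{p\<in>S n. p < q} \<noteq> {}" "{p\<in>S n. q < p} \<noteq> {}"
      then have "Max {p\<in>S n. p < q} < Min {p\<in>S n. q < p}"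
        using lo_mem hi_mem by (metis (mono_tags, lifting) mem_Collect_eq order.strict_trans)
      then show ?thesis
        using lo_mem[OF ne(1)] hi_mem[OF ne(2)] g
        unfolding lo_def hi_def P_def if_not_P[OF ne(1)] if_not_P[OF ne(2)] by blast
    qed (use g ab lo_mem hi_mem in \<open>simp_all add: lo_def hi_def P_def\<close>)
    have lo_ge: "R (g p) lo \<or> g p = lo" if "p \<in> S n" "p < q" for p
    proof -
      have ne: "{p\<in>S n. p < q} \<noteq> {}" using that by auto
      have "p \<le> Max {p\<in>S n. p < q}" using that fin by (intro Max_ge) auto
      then show ?thesis
        using lo_mem[OF ne] g that(1) unfolding lo_def P_def if_not_P[OF ne]
        by (auto simp: order_le_less)
    qed
    have hi_le: "R hi (g p) \<or> g p = hi" if "p \<in> S n" "q < p" for p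
    proof -
      have ne: "{p\<in>S n. q < p} \<noteq> {}" using that by auto
      have "Min {p\<in>S n. q < p} \<le> p" using that fin by (intro Min_le) auto
      then show ?thesis
        using hi_mem[OF ne] g that(1) unfolding hi_def P_def if_not_P[OF ne]
        by (auto simp: order_le_less)
    qed
    have lo_a: "R a lo \<or> a = lo"
      using lo_mem g unfolding lo_def P_def by auto
    have hi_b: "R hi b \<or> hi = b"
      using hi_mem g unfolding hi_def P_def by auto
    obtain c where c: "c \<in> T" "R lo c" "R c hi"
      using dense[OF lo_hi] by blast
    have "R a c" "R c b" "\<And>p. p \<in> S n \<Longrightarrow> p < q \<Longrightarrow> R (g p) c"
      "\<And>p. p \<in> S n \<Longrightarrow> q < p \<Longrightarrow> R c (g p)"
      using c lo_a hi_b lo_ge hi_le trans by metis+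
    moreover have "q \<notin> S n" using False by (simp add: q_def)
    ultimately have "P (Suc n) (g(q := c))"
      using g c(1) unfolding P_def S_Suc q_def[symmetric]
      by (auto simp: fun_upd_def)
    with \<open>q \<notin> S n\<close> show ?thesis by (intro exI[of _ "g(q := c)"]) auto
  qed
  have "\<exists>G. \<forall>n. P n (G n) \<and> (\<forall>p\<in>S n. G (Suc n) p = G n p)"
    by (rule dependent_nat_choice) (use step in \<open>auto simp: P_def S_def\<close>)
  then obtain G where G: "\<And>n. P n (G n)" and Suc: "\<And>n p. p \<in> S n \<Longrightarrow> G (Suc n) p = G n p"
    by blast
  have mono: "m \<le> n \<Longrightarrow> p \<in> S m \<Longrightarrow> p \<in> S n \<and> G n p = G m p" for m n p
    by (induction n rule: dec_induct) (auto simp: S_Suc Suc)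
  \<comment> \<open>\<open>S n\<close> holds the rationals with codes below \<open>n\<close>, so
    stage \<open>Suc (to_nat p)\<close> is sure to contain \<open>p\<close>, and later stages never
    change the value there.\<close>
  define f where "f p = G (Suc (to_nat p)) p" for p
  have mem: "p \<in> S (Suc (to_nat p))" for p
    by (simp add: S_Suc)
  have feq: "f p = G n p \<and> p \<in> S n" if "Suc (to_nat p) \<le> n" for n p
    using mono[OF that mem] by (simp add: f_def)
  show ?thesis
  proof
    show "range f \<subseteq> T"
      using G mem unfolding f_def P_def by blast
    fix p q :: rat
    assume "p < q"
    define n where "n = max (Suc (to_nat p)) (Suc (to_nat q))"
    have "f p = G n p" "p \<in> S n" "f q = G n q" "q \<in> S n"
      using feq unfolding n_def by auto
    with G[of n] \<open>p < q\<close> show "R (f p) (f q)"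
      unfolding P_def by auto
  qed
qed

text \<open>Basic open sets of the product prescribe membership of finitely many points. Hence a
  point is isolated in a family exactly when its trace on some finite set \<open>E\<close>
  determines it within the family, and the topology can be forgotten from here on.\<close>

lemma top_scattered_iff:
  assumes P: "P \<subseteq> Pow X"
  shows "top_scattered (subtopology (cantor_cube X) (char_fun X ` P)) \<longleftrightarrow>
    (\<forall>Y\<subseteq>P. Y \<noteq> {} \<longrightarrow>
      (\<exists>A\<in>Y. \<exists>E. finite E \<and> E \<subseteq> X \<and> (\<forall>B\<in>Y. B \<inter> E = A \<inter> E \<longrightarrow> B = A)))"
proof -
  let ?T = "subtopology (cantor_cube X) (char_fun X ` P)"
  have inj: "char_fun X A = char_fun X B \<longleftrightarrow> A = B" if "A \<subseteq> X" "B \<subseteq> X" for A B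
    using that unfolding char_fun_def fun_eq_iff restrict_def by auto
  have top: "topspace ?T = char_fun X ` P"
    by (auto simp: cantor_cube_def char_fun_def)
  \<comment> \<open>A neighbourhood contains a box, and the finitely many coordinates restricted by
    the box form \<open>E\<close>.\<close>
  have basic: "\<exists>E. finite E \<and> E \<subseteq> X \<and> (\<forall>B\<in>P. B \<inter> E = A \<inter> E \<longrightarrow> char_fun X B \<in> U)"
    if U: "openin ?T U" "char_fun X A \<in> U" for U A
  proof -
    obtain W where W: "openin (cantor_cube X) W" "U = W \<inter> char_fun X ` P"
      using U(1) unfolding openin_subtopology by blast
    then obtain V where V: "finite {i \<in> X. V i \<noteq> UNIV}" "char_fun X A \<in> Pi\<^sub>E X V" "Pi\<^sub>E X V \<subseteq> W"
      using U(2) unfolding cantor_cube_def openin_product_topology_alt by auto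
    have "char_fun X B \<in> Pi\<^sub>E X V" if "B \<inter> {i \<in> X. V i \<noteq> UNIV} = A \<inter> {i \<in> X. V i \<noteq> UNIV}" for B
    proof (rule PiE_I)
      fix i assume i: "i \<in> X"
      then show "char_fun X B i \<in> V i"
      proof (cases "V i = UNIV")
        case False
        with that i have "i \<in> B \<longleftrightarrow> i \<in> A" by blast
        then show ?thesis
          using PiE_mem[OF V(2) i] i by (simp add: char_fun_def)
      qed simp
    qed (simp add: char_fun_def)
    with V(3) W(2) have "\<forall>B\<in>P. B \<inter> {i \<in> X. V i \<noteq> UNIV} = A \<inter> {i \<in> X. V i \<noteq> UNIV} \<longrightarrow> char_fun X B \<in> U"
      by blast
    with V(1) show ?thesis
      by (intro exI[of _ "{i \<in> X. V i \<noteq> UNIV}"]) simp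
  qed
  have cyl: "openin ?T {char_fun X B | B. B \<in> P \<and> B \<inter> E = A \<inter> E}" if "finite E" "E \<subseteq> X" for A E
  proof -
    have "openin (cantor_cube X) (Pi\<^sub>E X (\<lambda>i. if i \<in> E then {i \<in> A} else UNIV))"
      unfolding cantor_cube_def openin_PiE_gen
      using that by (auto intro: finite_subset[OF _ that(1)])
    moreover have "{char_fun X B | B. B \<in> P \<and> B \<inter> E = A \<inter> E} =
        Pi\<^sub>E X (\<lambda>i. if i \<in> E then {i \<in> A} else UNIV) \<inter> char_fun X ` P"
    proof (intro equalityI subsetI)
      fix h assume "h \<in> Pi\<^sub>E X (\<lambda>i. if i \<in> E then {i \<in> A} else UNIV) \<inter> char_fun X ` P"
      then obtain B where B: "h = char_fun X B" "B \<in> P"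
        and h: "h \<in> Pi\<^sub>E X (\<lambda>i. if i \<in> E then {i \<in> A} else UNIV)" by blast
      have "i \<in> B \<longleftrightarrow> i \<in> A" if "i \<in> E" for i
        using PiE_mem[OF h, of i] that \<open>E \<subseteq> X\<close> B(1) by (auto simp: char_fun_def)
      then have "B \<inter> E = A \<inter> E" by blast
      with B show "h \<in> {char_fun X B | B. B \<in> P \<and> B \<inter> E = A \<inter> E}" by blast
    qed (use that in \<open>auto simp: char_fun_def\<close>)
    ultimately show ?thesis by (auto simp: openin_subtopology)
  qed
  show ?thesis
  proof (intro iffI allI impI)
    fix Y assume ts: "top_scattered ?T" and Y: "Y \<subseteq> P" "Y \<noteq> {}"
    have "\<exists>x\<in>char_fun X ` Y. \<exists>U. openin ?T U \<and> U \<inter> char_fun X ` Y = {x}"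
      using ts[unfolded top_scattered_def top, THEN spec, of "char_fun X ` Y"] Y
      by (metis image_is_empty image_mono)
    then obtain A U where A: "A \<in> Y" "openin ?T U" "U \<inter> char_fun X ` Y = {char_fun X A}"
      by blast
    have "char_fun X A \<in> U" using A(3) by blast
    from basic[OF A(2) this]
    obtain E where E: "finite E" "E \<subseteq> X" "\<forall>B\<in>P. B \<inter> E = A \<inter> E \<longrightarrow> char_fun X B \<in> U"
      by blast
    have "B = A" if B: "B \<in> Y" "B \<inter> E = A \<inter> E" for B
    proof -
      have "char_fun X B \<in> U" using E(3) B Y(1) by blast
      then have "char_fun X B = char_fun X A" using A(3) B(1) by blast
      moreover have "B \<subseteq> X" "A \<subseteq> X" using A(1) B(1) Y(1) P by blast+
      ultimately show ?thesis using inj by simp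
    qed
    with E(1,2) show "\<exists>A\<in>Y. \<exists>E. finite E \<and> E \<subseteq> X \<and> (\<forall>B\<in>Y. B \<inter> E = A \<inter> E \<longrightarrow> B = A)"
      using A(1) by blast
  next
    assume iso: "\<forall>Y\<subseteq>P. Y \<noteq> {} \<longrightarrow>
      (\<exists>A\<in>Y. \<exists>E. finite E \<and> E \<subseteq> X \<and> (\<forall>B\<in>Y. B \<inter> E = A \<inter> E \<longrightarrow> B = A))"
    show "top_scattered ?T"
      unfolding top_scattered_def top
    proof (intro allI impI)
      fix Z assume Z: "Z \<subseteq> char_fun X ` P \<and> Z \<noteq> {}"
      then obtain Y where Y: "Y \<subseteq> P" "Z = char_fun X ` Y" "Y \<noteq> {}"
        by (metis image_empty subset_imageE)
      then obtain A E where A: "A \<in> Y" "finite E" "E \<subseteq> X" "\<forall>B\<in>Y. B \<inter> E = A \<inter> E \<longrightarrow> B = A"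
        using iso by metis
      have "{char_fun X B | B. B \<in> P \<and> B \<inter> E = A \<inter> E} \<inter> Z = {char_fun X A}"
      proof (intro equalityI subsetI)
        fix z assume "z \<in> {char_fun X B | B. B \<in> P \<and> B \<inter> E = A \<inter> E} \<inter> Z"
        then obtain B B' where B: "z = char_fun X B" "B \<in> P" "B \<inter> E = A \<inter> E"
          "z = char_fun X B'" "B' \<in> Y"
          using Y(2) by auto
        then have "B = B'" using inj P Y(1) by (metis PowD subsetD)
        then show "z \<in> {char_fun X A}" using A B by auto
      qed (use A Y in auto)
      then show "\<exists>x\<in>Z. \<exists>U. openin ?T U \<and> U \<inter> Z = {x}"
        using cyl[OF A(2,3)] A(1) Y(2) by blast
    qed
  qed
qed

text \<open>If no member of the chain of down-sets were isolated, then between two members that are not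
  adjacent there would always be two further members with room on both sides. The points of \<open>T\<close> in
  these gaps form a copy of the rationals.\<close>
lemma isolated_downset:
  assumes T: "order_scattered_real T" and "\<D> \<noteq> {}"
    and down: "\<And>D. D \<in> \<D> \<Longrightarrow> D \<subseteq> T \<and> (\<forall>s\<in>T. \<forall>t\<in>D. s \<le> t \<longrightarrow> s \<in> D)"
  shows "\<exists>D\<in>\<D>. \<exists>E. finite E \<and> E \<subseteq> T \<and> (\<forall>D'\<in>\<D>. D' \<inter> E = D \<inter> E \<longrightarrow> D' = D)"
proof (rule ccontr)
  assume "\<not> ?thesis"
  then have limit: "\<exists>D'\<in>\<D>. D' \<inter> E = D \<inter> E \<and> D' \<noteq> D" if "D \<in> \<D>" "finite E" "E \<subseteq> T" for D E
    using that by metis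
  have chain: "D \<subset> D' \<or> D' \<subset> D" if "D \<in> \<D>" "D' \<in> \<D>" "D \<noteq> D'" for D D'
  proof -
    have "D \<subseteq> D' \<or> D' \<subseteq> D"
    proof (rule ccontr)
      assume "\<not> ?thesis"
      then obtain s t where "s \<in> D" "s \<notin> D'" "t \<in> D'" "t \<notin> D" by blast
      then show False
        using down[OF that(1)] down[OF that(2)] by (metis linear subsetD)
    qed
    with that(3) show ?thesis by blast
  qed
  define P where "P D1 D2 \<longleftrightarrow> D1 \<in> \<D> \<and> D2 \<in> \<D> \<and> (\<exists>M\<in>\<D>. D1 \<subset> M \<and> M \<subset> D2)" for D1 D2
  have PI: "P D1 D2" if "D1 \<in> \<D>" "M \<in> \<D>" "D2 \<in> \<D>" "D1 \<subset> M" "M \<subset> D2" for D1 M D2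
    using that unfolding P_def by blast
  have PD: "D1 \<in> \<D>" "D2 \<in> \<D>" if "P D1 D2" for D1 D2
    using that unfolding P_def by blast+
  \<comment> \<open>\<open>s\<close> and \<open>t\<close> witness that the middle member
    \<open>M\<close> differs from both ends. Another member with the same trace on
    \<open>{s, t}\<close> is again strictly between the ends, and the chain property compares it
    with \<open>M\<close>.\<close>
  have two: "\<exists>M1 M2. M1 \<in> \<D> \<and> M2 \<in> \<D> \<and> D1 \<subset> M1 \<and> M1 \<subset> M2 \<and> M2 \<subset> D2" if D: "P D1 D2" for D1 D2
  proof -
    obtain M where M: "M \<in> \<D>" "D1 \<subset> M" "M \<subset> D2" "D1 \<in> \<D>" "D2 \<in> \<D>"
      using D by (auto simp: P_def)
    then obtain s t where st: "s \<in> M" "s \<notin> D1" "t \<in> D2" "t \<notin> M" by blast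
    then have "{s, t} \<subseteq> T" using down M by blast
    then obtain N where N: "N \<in> \<D>" "N \<inter> {s, t} = M \<inter> {s, t}" "N \<noteq> M"
      using limit[OF M(1), of "{s,t}"] by blast
    then have "s \<in> N" "t \<notin> N" using st by blast+
    then have "D1 \<subset> N" "N \<subset> D2" using chain N(1) M(4,5) st by blast+
    then show ?thesis using chain[OF N(1) M(1) N(3)] M N(1) by blast
  qed
  \<comment> \<open>Three uses of \<open>two\<close> put enough members in a row to leave a middle
    member on either side of the gap between \<open>K1\<close> and \<open>K2\<close>.\<close>
  have split: "\<exists>E1 E2. P D1 E1 \<and> E1 \<subset> E2 \<and> P E2 D2" if D: "P D1 D2" for D1 D2
  proof -
    obtain M1 M2 where M: "M1 \<in> \<D>" "M2 \<in> \<D>" "D1 \<subset> M1" "M1 \<subset> M2" "M2 \<subset> D2"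
      using two[OF D] by blast
    have "P D1 M2" using PI[OF PD(1)[OF D] M(1,2,3,4)] .
    from two[OF this]
    obtain N1 N2 where N: "N1 \<in> \<D>" "N2 \<in> \<D>" "D1 \<subset> N1" "N1 \<subset> N2" "N2 \<subset> M2"
      by blast
    have "P N1 M2" using PI[OF N(1,2) M(2) N(4,5)] .
    from two[OF this]
    obtain K1 K2 where K: "K1 \<in> \<D>" "K2 \<in> \<D>" "N1 \<subset> K1" "K1 \<subset> K2" "K2 \<subset> M2"
      by blast
    have "P D1 K1" "P K2 D2"
      using PI[OF PD(1)[OF D] N(1) K(1) N(3) K(3)] PI[OF K(2) M(2) PD(2)[OF D] K(5) M(5)] .
    with K(4) show ?thesis by blast
  qed
  \<comment> \<open>The order of \<open>T\<close> itself need not be dense. Keeping only the pairs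
    separated by non-adjacent members gives a dense transitive relation, to which
    \<open>rat_embedding\<close> applies; \<open>far_less\<close> leads back to the usual
    order.\<close>
  define far where "far s t \<longleftrightarrow> s \<in> T \<and> t \<in> T \<and> (\<exists>D1 D2. P D1 D2 \<and> s \<in> D1 \<and> t \<notin> D2)" for s t
  have sub: "P D1 D2 \<Longrightarrow> D1 \<subset> D2" for D1 D2
    unfolding P_def using psubset_trans by blast
  have far_less: "s < t" if st: "far s t" for s t
  proof -
    obtain D1 D2 where "P D1 D2" "s \<in> D1" "t \<notin> D2" "t \<in> T" "D2 \<in> \<D>"
      using st unfolding far_def P_def by blast
    then show ?thesis using down[of D2] sub[of D1 D2] by (meson leI psubsetD)
  qed
  have far_trans: "far s u" if su: "far s t" "far t u" for s t u
  proof -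
    obtain D1 D2 E1 E2 where D: "P D1 D2" "s \<in> D1" "t \<notin> D2" "P E1 E2" "t \<in> E1" "u \<notin> E2"
      using su unfolding far_def by blast
    have "D2 \<subset> E1" using chain[of D2 E1] PD[OF D(1)] PD[OF D(4)] D(3,5) by blast
    then have "D1 \<subset> E1" using sub[OF D(1)] psubset_trans by metis
    then have "P D1 E2" using PI[OF PD(1)[OF D(1)] PD(1)[OF D(4)] PD(2)[OF D(4)]] sub[OF D(4)] by simp
    then show ?thesis using D su unfolding far_def by blast
  qed
  have far_dense: "\<exists>u\<in>T. far s u \<and> far u t" if st: "far s t" for s t
  proof -
    obtain D1 D2 where D: "P D1 D2" "s \<in> D1" "t \<notin> D2"
      using st unfolding far_def by blast
    then obtain E1 E2 where E: "P D1 E1" "E1 \<subset> E2" "P E2 D2"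
      using split by blast
    then obtain u where "u \<in> E2" "u \<notin> E1" by blast
    moreover have "u \<in> T" using \<open>u \<in> E2\<close> E(3) down by (auto simp: P_def)
    ultimately show ?thesis using D E st unfolding far_def by blast
  qed
  obtain A where A: "A \<in> \<D>" using \<open>\<D> \<noteq> {}\<close> by blast
  obtain B where B: "B \<in> \<D>" "B \<noteq> A" using limit[OF A, of "{}"] by blast
  obtain t where t: "t \<in> T" "t \<in> A \<longleftrightarrow> t \<notin> B" using A B down by blast
  \<comment> \<open>\<open>t\<close> separates \<open>A\<close> from \<open>B\<close>, while
    \<open>C\<close> agrees with \<open>A\<close> at \<open>t\<close>. So these are three distinct
    members of a chain, and the middle one makes the outer two satisfy \<open>P\<close>.\<close>
  obtain C where C: "C \<in> \<D>" "C \<noteq> A" "C \<inter> {t} = A \<inter> {t}" using limit[OF A, of "{t}"] t by blast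
  have "C \<noteq> B" using C t by auto
  then have "\<exists>D1 D2. P D1 D2"
    using chain[OF A B(1)] chain[OF A C(1)] chain[OF B(1) C(1)] A B C unfolding P_def by metis
  then obtain D1 D2 E1 E2 where E: "P D1 E1" "E1 \<subset> E2" "P E2 D2" using split by metis
  \<comment> \<open>The second split makes \<open>F2\<close> non-empty, which provides the left end
    \<open>a\<close>; the right end \<open>b\<close> comes from the gap between \<open>E1\<close>
    and \<open>E2\<close>.\<close>
  then obtain F1 F2 where F: "F1 \<subset> F2" "P F2 E1" using split by metis
  obtain a b where "a \<in> F2" "b \<in> E2" "b \<notin> E1" using E(2) F(1) by blast
  moreover have "a \<in> T" "b \<in> T" using calculation E(3) F(2) down by (auto simp: P_def)
  ultimately have "far a b" using F(2) unfolding far_def by blast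
  with far_trans far_dense obtain f :: "rat \<Rightarrow> real"
    where "range f \<subseteq> T" "\<And>p q. p < q \<Longrightarrow> far (f p) (f q)"
    using rat_embedding[of far T a b] by blast
  with far_less T show False unfolding order_scattered_real_def by blast
qed

section \<open>Convexly independent sets\<close>

lemma separate_finite_sets:
  fixes L R :: "real set"
  assumes "finite L" "finite R" "\<And>l r. l \<in> L \<Longrightarrow> r \<in> R \<Longrightarrow> l < r"
  obtains m where "\<And>l. l \<in> L \<Longrightarrow> l < m" "\<And>r. r \<in> R \<Longrightarrow> m < r"
proof (cases "L = {} \<or> R = {}")
  case True
  then show ?thesis
  proof
    assume "L = {}"
    then show ?thesis
      using that[of "Min (insert 0 R) - 1"] assms(2)
      by (smt (verit) Min_le empty_iff finite_insert insertI2)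
  next
    assume "R = {}"
    then show ?thesis
      using that[of "Max (insert 0 L) + 1"] assms(1)
      by (smt (verit) Max_ge empty_iff finite_insert insertI2)
  qed
next
  case False
  then have "Max L < Min R"
    using assms by simp
  then obtain m where "Max L < m" "m < Min R"
    using dense by blast
  with that[of m] False assms show ?thesis by simp
qed

text \<open>For three points this is the second divided difference of \<open>y\<close> with respect to \<open>x\<close>. Its sign
  tells a cup from a cap, and since it is symmetric it colours unordered triples.\<close>
definition divided_difference :: "('a \<Rightarrow> real) \<Rightarrow> ('a \<Rightarrow> real) \<Rightarrow> 'a set \<Rightarrow> real" where
  "divided_difference x y S = (\<Sum>p\<in>S. y p / (\<Prod>q\<in>S - {p}. x p - x q))"

lemma divided_difference_uminus:
  "divided_difference x (\<lambda>p. - y p) S = - divided_difference x y S"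
  by (simp add: divided_difference_def sum_negf)

text \<open>Translates the colour of a triple into slopes: for \<open>x p < x q < x r\<close> its
  sign tells whether the slope rises or falls from the first pair to the second.\<close>

lemma divided_difference_three:
  fixes p q r :: 'a
  assumes "p \<noteq> q" "p \<noteq> r" "q \<noteq> r" "x p \<noteq> x q" "x p \<noteq> x r" "x q \<noteq> x r"
  shows "divided_difference x y {p, q, r} * (x r - x p) =
    (y r - y q) / (x r - x q) - (y q - y p) / (x q - x p)"
proof -
  have diff: "{p, q, r} - {p} = {q, r}" "{p, q, r} - {q} = {p, r}" "{p, q, r} - {r} = {p, q}"
    using assms by auto
  have "divided_difference x y {p, q, r} = y p / ((x p - x q) * (x p - x r)) +
      (y q / ((x q - x p) * (x q - x r)) + y r / ((x r - x p) * (x r - x q)))"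
    using assms(1-3) by (simp add: divided_difference_def diff)
  also have "\<dots> = y p / ((x q - x p) * (x r - x p)) - y q / ((x q - x p) * (x r - x q)) +
      y r / ((x r - x p) * (x r - x q))"
    using minus_mult_minus[of "x q - x p" "x r - x p"]
      minus_divide_right[of "y q" "(x q - x p) * (x r - x q)"]
      mult_minus_right[of "x q - x p" "x r - x q"] by simp
  finally have dd: "divided_difference x y {p, q, r} = \<dots>" .
  define a b where "a = x q - x p" and "b = x r - x q"
  have ab: "a \<noteq> 0" "b \<noteq> 0" "a + b \<noteq> 0" "x r - x p = a + b"
    using assms by (auto simp: a_def b_def)
  have "(y p / (a * (a + b)) - y q / (a * b) + y r / ((a + b) * b)) * (a + b) =
      (y r - y q) / b - (y q - y p) / a"
    using ab(1-3) by (simp add: divide_simps) (simp add: algebra_simps)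
  then show ?thesis
    unfolding dd ab(4) a_def[symmetric] b_def[symmetric] .
qed

text \<open>Slopes from \<open>c\<close> to points on its left are smaller than those to points on
  its right. A line through \<open>c\<close> with a slope \<open>m\<close> in between lies strictly
  below the other points, so \<open>y - m * x\<close> is larger at each of them than at
  \<open>c\<close>, and no convex combination of them equals \<open>c\<close>.\<close>

lemma cup_convex_independent:
  fixes x y :: "'v::real_vector \<Rightarrow> real"
  assumes x: "linear x" and y: "linear y" and inj: "inj_on x C"
    and cup: "\<And>S. S \<subseteq> C \<Longrightarrow> finite S \<Longrightarrow> card S = 3 \<Longrightarrow> divided_difference x y S > 0"
    and c: "c \<in> C"
  shows "c \<notin> convex hull (C - {c})"
proof
  assume "c \<in> convex hull (C - {c})"
  then obtain S u where S: "finite S" "S \<subseteq> C - {c}" "\<forall>v\<in>S. 0 \<le> u v" "sum u S = 1"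
      "(\<Sum>v\<in>S. u v *\<^sub>R v) = c"
    unfolding convex_hull_explicit by blast
  define slope where "slope v = (y v - y c) / (x v - x c)" for v
  have x_ne: "x v \<noteq> x c" if "v \<in> S" for v
    using that S(2) inj c by (auto dest: inj_onD)
  have slopes: "slope v < slope w" if vw: "v \<in> S" "w \<in> S" "x v < x c" "x c < x w" for v w
  proof -
    have ne: "v \<noteq> c" "v \<noteq> w" "c \<noteq> w" using vw by auto
    then have "0 < divided_difference x y {v, c, w} * (x w - x v)"
      using cup[of "{v, c, w}"] vw c S(2) by (intro mult_pos_pos) auto
    also have "\<dots> = slope w - slope v"
      using divided_difference_three[of v c w x y] ne vw
      unfolding slope_def by (simp add: minus_divide_divide [symmetric, of "y c - y v"])
    finally show ?thesis by simp
  qed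
  \<comment> \<open>Only the finitely many points of the convex combination matter, so a separating
    slope exists even if one side is empty.\<close>
  obtain m where m: "\<And>l. l \<in> slope ` {v \<in> S. x v < x c} \<Longrightarrow> l < m"
      "\<And>r. r \<in> slope ` {v \<in> S. x c < x v} \<Longrightarrow> m < r"
  proof (rule separate_finite_sets[of "slope ` {v \<in> S. x v < x c}" "slope ` {v \<in> S. x c < x v}"])
    fix l r assume "l \<in> slope ` {v \<in> S. x v < x c}" "r \<in> slope ` {v \<in> S. x c < x v}"
    then show "l < r" using slopes by blast
  qed (use S(1) in auto)
  have above: "y v - y c - m * (x v - x c) > 0" if v: "v \<in> S" for v
  proof (cases "x v < x c")
    case True
    then have "slope v < m" using m(1) v by blast
    with True show ?thesis by (simp add: slope_def neg_divide_less_eq)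
  next
    case False
    then have "x c < x v" using x_ne[OF v] by simp
    moreover from this have "m < slope v" using m(2) v by blast
    ultimately show ?thesis by (simp add: slope_def pos_less_divide_eq)
  qed
  have eq: "(\<Sum>v\<in>S. u v * f v) = f c" if "linear f" for f :: "'v \<Rightarrow> real"
    using linear_sum[OF that, of "\<lambda>v. u v *\<^sub>R v" S] S(5) by (simp add: linear_scale[OF that])
  \<comment> \<open>The weighted mean of the heights above the line is the height of
    \<open>c\<close>, which is zero; as all heights are positive, all weights vanish.\<close>
  have "(\<Sum>v\<in>S. u v * (y v - y c - m * (x v - x c))) =
      (\<Sum>v\<in>S. u v * y v) - sum u S * y c - m * ((\<Sum>v\<in>S. u v * x v) - sum u S * x c)"
    by (simp add: sum_distrib_left sum_distrib_right sum_subtractf sum.distrib algebra_simps)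
  then have "(\<Sum>v\<in>S. u v * (y v - y c - m * (x v - x c))) = 0"
    using eq[OF x] eq[OF y] S(4) by simp
  moreover have "u v * (y v - y c - m * (x v - x c)) \<ge> 0" if "v \<in> S" for v
    using above[OF that] S(3) that by simp
  ultimately have "\<forall>v\<in>S. u v * (y v - y c - m * (x v - x c)) = 0"
    using sum_nonneg_eq_0_iff[OF S(1), of "\<lambda>v. u v * (y v - y c - m * (x v - x c))"] by simp
  then have "\<forall>v\<in>S. u v = 0" using above by force
  with S(4) show False by simp
qed

text \<open>Ramsey's theorem for triples coloured by sign, used for one function of \<open>K\<close>
  at a time. A homogeneous set of nonzero sign ends the search; inside one of sign zero it continues
  with the remaining functions, since vanishing passes to subsets.\<close>

lemma homogeneous_divided_differences:
  assumes "finite K" "infinite A"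
  shows "(\<exists>y\<in>K. \<exists>B\<subseteq>A. infinite B \<and>
        ((\<forall>S\<subseteq>B. finite S \<and> card S = 3 \<longrightarrow> divided_difference x y S > 0) \<or>
         (\<forall>S\<subseteq>B. finite S \<and> card S = 3 \<longrightarrow> divided_difference x y S < 0))) \<or>
    (\<exists>B\<subseteq>A. infinite B \<and> (\<forall>y\<in>K. \<forall>S\<subseteq>B. finite S \<and> card S = 3 \<longrightarrow> divided_difference x y S = 0))"
  using assms
proof (induction K arbitrary: A rule: finite_induct)
  case empty
  then show ?case by blast
next
  case (insert y K)
  define col :: "'a set \<Rightarrow> nat" where
    "col S = (if divided_difference x y S > 0 then 0 else if divided_difference x y S < 0 then 1 else 2)" for S
  have "\<forall>S. S \<subseteq> A \<and> finite S \<and> card S = 3 \<longrightarrow> col S < 3"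
    by (simp add: col_def)
  then obtain B t where B: "B \<subseteq> A" "infinite B" "t < 3"
      and hom: "\<forall>S. S \<subseteq> B \<and> finite S \<and> card S = 3 \<longrightarrow> col S = t"
    using Ramsey[OF insert.prems, of 3 col 3] by blast
  have col: "col S = 0 \<longleftrightarrow> divided_difference x y S > 0" "col S = 1 \<longleftrightarrow> divided_difference x y S < 0"
      "col S = 2 \<longleftrightarrow> divided_difference x y S = 0" for S
    by (auto simp: col_def)
  consider "t = 0" | "t = 1" | "t = 2" using B(3) by linarith
  then show ?case
  proof cases
    case 1
    with hom have "\<forall>S\<subseteq>B. finite S \<and> card S = 3 \<longrightarrow> divided_difference x y S > 0"
      by (simp flip: col(1))
    with B show ?thesis by blast
  next
    case 2
    with hom have "\<forall>S\<subseteq>B. finite S \<and> card S = 3 \<longrightarrow> divided_difference x y S < 0"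
      by (simp flip: col(2))
    with B show ?thesis by blast
  next
    case 3
    with hom have zero: "\<forall>S\<subseteq>B. finite S \<and> card S = 3 \<longrightarrow> divided_difference x y S = 0"
      by (simp flip: col(3))
    from insert.IH[OF B(2)] show ?thesis
    proof (elim disjE)
      assume "\<exists>C\<subseteq>B. infinite C \<and> (\<forall>y\<in>K. \<forall>S\<subseteq>C. finite S \<and> card S = 3 \<longrightarrow> divided_difference x y S = 0)"
      then obtain C where C: "C \<subseteq> B" "infinite C"
        "\<forall>y\<in>K. \<forall>S\<subseteq>C. finite S \<and> card S = 3 \<longrightarrow> divided_difference x y S = 0" by blast
      have "\<forall>S\<subseteq>C. finite S \<and> card S = 3 \<longrightarrow> divided_difference x y S = 0"
        using zero C(1) by blast
      with C(3) have "\<forall>z\<in>insert y K. \<forall>S\<subseteq>C. finite S \<and> card S = 3 \<longrightarrow> divided_difference x z S = 0"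
        by blast
      moreover have "C \<subseteq> A" using C(1) B(1) by blast
      ultimately show ?thesis using C(2) by blast
    next
      assume "\<exists>y\<in>K. \<exists>C\<subseteq>B. infinite C \<and>
        ((\<forall>S\<subseteq>C. finite S \<and> card S = 3 \<longrightarrow> divided_difference x y S > 0) \<or>
         (\<forall>S\<subseteq>C. finite S \<and> card S = 3 \<longrightarrow> divided_difference x y S < 0))"
      then obtain z C where "z \<in> K" "C \<subseteq> B" and C: "infinite C \<and>
        ((\<forall>S\<subseteq>C. finite S \<and> card S = 3 \<longrightarrow> divided_difference x z S > 0) \<or>
         (\<forall>S\<subseteq>C. finite S \<and> card S = 3 \<longrightarrow> divided_difference x z S < 0))"
        by (elim bexE exE conjE) simp
      then have "z \<in> insert y K" "C \<subseteq> A" using B(1) by auto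
      show ?thesis
        by (rule disjI1, rule bexI[OF _ \<open>z \<in> insert y K\<close>], rule exI[of _ C], rule conjI[OF \<open>C \<subseteq> A\<close> C])
    qed
  qed
qed

section \<open>Sets without three collinear points\<close>

definition no_three_collinear :: "'v::real_vector set \<Rightarrow> bool" where
  "no_three_collinear A \<longleftrightarrow>
    (\<forall>a\<in>A. \<forall>b\<in>A. \<forall>c\<in>A. a \<noteq> b \<longrightarrow> c \<noteq> a \<longrightarrow> c \<noteq> b \<longrightarrow> c \<notin> line a (b - a))"

lemma no_three_collinearD:
  "no_three_collinear A \<Longrightarrow> {a, b, c} \<subseteq> A \<Longrightarrow> a \<noteq> b \<Longrightarrow> c \<noteq> a \<Longrightarrow> c \<noteq> b \<Longrightarrow>
    c \<notin> line a (b - a)"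
  by (simp add: no_three_collinear_def)

definition convex_independent :: "'v::real_vector set \<Rightarrow> bool" where
  "convex_independent B \<longleftrightarrow> (\<forall>b\<in>B. b \<notin> convex hull (B - {b}))"

lemma independent_imp_convex_independent:
  assumes "independent B"
  shows "convex_independent B"
  using assms convex_hull_subset_span unfolding convex_independent_def dependent_def by blast

text \<open>A set spanned by finitely many basis vectors has a coordinate \<open>x\<close> with infinitely many values. If all
  other coordinates had vanishing divided differences on a subset, that subset would lie on a line.\<close>
lemma infinite_convex_independent_subset:
  fixes A :: "'v::real_vector set"
  assumes A: "infinite A" and ntc: "no_three_collinear A"
  obtains B where "B \<subseteq> A" "infinite B" "convex_independent B"
proof -
  obtain K where K: "K \<subseteq> A" "independent K" "A \<subseteq> span K"
    using maximal_independent_subset by blast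
  show ?thesis
  proof (cases "finite K")
    \<comment> \<open>An infinite linearly independent subset is already convexly
      independent.\<close>
    case False
    with K that independent_imp_convex_independent show ?thesis by blast
  next
    case fin: True
    \<comment> \<open>\<open>representation K\<close> behaves linearly only on the span of
      \<open>K\<close>; extending \<open>K\<close> to a basis \<open>E\<close> makes every
      \<open>coord b\<close> linear on the whole space.\<close>
    define E where "E = extend_basis K"
    have E: "independent E" "span E = UNIV" "K \<subseteq> E"
      using K(2) by (simp_all add: E_def independent_extend_basis extend_basis_superset)
    define coord where "coord b v = representation E v b" for b v
    have lin: "linear (coord b)" for b
      by (rule linearI) (simp_all add: coord_def representation_add[OF E(1)] representation_scale[OF E(1)] E(2))
    have expand: "(\<Sum>b\<in>K. coord b v *\<^sub>R b) = v" if "v \<in> A" for v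
    proof -
      have "representation E v = representation K v"
        using representation_extend[OF E(1) _ E(3)] that K(3) by blast
      then show ?thesis
        using sum_representation_eq[OF K(2) _ fin subset_refl, of v] that K(3)
        by (auto simp: coord_def)
    qed
    \<comment> \<open>Otherwise \<open>A\<close> would consist of combinations of \<open>K\<close>
      with coefficients from finitely many values.\<close>
    have "\<exists>b\<in>K. infinite (coord b ` A)"
    proof (rule ccontr)
      assume "\<not> ?thesis"
      then have "finite (Pi\<^sub>E K (\<lambda>b. coord b ` A))"
        using fin by (intro finite_PiE) auto
      moreover have "A \<subseteq> (\<lambda>h. \<Sum>b\<in>K. h b *\<^sub>R b) ` Pi\<^sub>E K (\<lambda>b. coord b ` A)"
      proof
        fix v assume "v \<in> A"
        then show "v \<in> (\<lambda>h. \<Sum>b\<in>K. h b *\<^sub>R b) ` Pi\<^sub>E K (\<lambda>b. coord b ` A)"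
          using expand[of v] by (intro image_eqI[of _ _ "\<lambda>b\<in>K. coord b v"]) auto
      qed
      ultimately show False using A finite_surj by blast
    qed
    then obtain b where b: "b \<in> K" "infinite (coord b ` A)" by blast
    \<comment> \<open>One point is kept for each value, so that the coordinate separates the points
      of \<open>A'\<close>.\<close>
    obtain A' where A': "A' \<subseteq> A" "inj_on (coord b) A'" "coord b ` A = coord b ` A'"
      using subset_image_inj[of "coord b ` A" "coord b" A] by blast
    define x where "x = coord b"
    have "infinite A'" using A'(3) b(2) by auto
    from homogeneous_divided_differences[of "coord ` K", OF _ this, of x] fin
    consider (cup) c B where "B \<subseteq> A'" "infinite B"
        "\<forall>S\<subseteq>B. finite S \<and> card S = 3 \<longrightarrow> divided_difference x (coord c) S > 0"
      | (cap) c B where "B \<subseteq> A'" "infinite B"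
        "\<forall>S\<subseteq>B. finite S \<and> card S = 3 \<longrightarrow> divided_difference x (coord c) S < 0"
      | (flat) B where "B \<subseteq> A'" "infinite B"
        "\<forall>c\<in>K. \<forall>S\<subseteq>B. finite S \<and> card S = 3 \<longrightarrow> divided_difference x (coord c) S = 0"
      by (auto 0 3)
    then show ?thesis
    proof cases
      case cup
      have "convex_independent B"
        unfolding convex_independent_def
        using cup_convex_independent[OF lin lin, of b B c] cup inj_on_subset[OF A'(2) cup(1)]
        by (simp add: x_def)
      with cup A'(1) that show ?thesis by blast
    next
      case cap
      have "linear (\<lambda>v. - coord c v)"
        using linear_compose_neg[OF lin] .
      then have "convex_independent B"
        unfolding convex_independent_def
        using cup_convex_independent[OF lin, of "\<lambda>v. - coord c v" b B] cap inj_on_subset[OF A'(2) cap(1)]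
        by (simp add: x_def divided_difference_uminus)
      with cap A'(1) that show ?thesis by blast
    next
      case flat
      obtain T where "T \<subseteq> B" "finite T" "card T = 3"
        using infinite_arbitrarily_large[OF flat(2)] by metis
      then obtain p q r where pqr: "T = {p, q, r}" "p \<noteq> q" "p \<noteq> r" "q \<noteq> r"
        by (auto simp: card_3_iff)
      have in_A: "p \<in> A" "q \<in> A" "r \<in> A" and in_A': "p \<in> A'" "q \<in> A'" "r \<in> A'"
        using \<open>T \<subseteq> B\<close> flat(1) A'(1) pqr(1) by auto
      then have x_ne: "x p \<noteq> x q" "x p \<noteq> x r" "x q \<noteq> x r"
        using A'(2) pqr unfolding x_def by (auto dest: inj_onD)
      \<comment> \<open>The parameter of \<open>r\<close> on the line through \<open>p\<close> and
        \<open>q\<close>, read off from the coordinate \<open>x\<close>. Vanishing divided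
        differences give every other coordinate the same parameter.\<close>
      define s where "s = (x r - x p) / (x q - x p)"
      have coord_eq: "coord c r = coord c p + s * (coord c q - coord c p)" if "c \<in> K" for c
      proof -
        have "divided_difference x (coord c) {p, q, r} = 0"
          using flat(3) that \<open>T \<subseteq> B\<close> \<open>finite T\<close> \<open>card T = 3\<close> pqr(1) by blast
        then have "(coord c r - coord c q) / (x r - x q) = (coord c q - coord c p) / (x q - x p)"
          using divided_difference_three[of p q r x "coord c"] pqr x_ne by simp
        then have "coord c r - coord c q = (coord c q - coord c p) / (x q - x p) * (x r - x q)"
          using x_ne by (simp add: field_simps)
        moreover have "s = 1 + (x r - x q) / (x q - x p)"
          using x_ne by (simp add: s_def field_simps)
        ultimately show ?thesis by (simp add: algebra_simps)
      qed
      have "r = (\<Sum>c\<in>K. coord c r *\<^sub>R c)"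
        using expand in_A by simp
      also have "\<dots> = (\<Sum>c\<in>K. (coord c p + s * (coord c q - coord c p)) *\<^sub>R c)"
        by (simp add: coord_eq)
      also have "\<dots> = (\<Sum>c\<in>K. coord c p *\<^sub>R c) + s *\<^sub>R ((\<Sum>c\<in>K. coord c q *\<^sub>R c) - (\<Sum>c\<in>K. coord c p *\<^sub>R c))"
        by (simp add: algebra_simps sum.distrib sum_subtractf scaleR_sum_right)
      also have "\<dots> = p + s *\<^sub>R (q - p)"
        using expand in_A by simp
      finally have "r \<in> line p (q - p)" by (auto simp: line_def)
      with ntc in_A pqr show ?thesis unfolding no_three_collinear_def by metis
    qed
  qed
qed

text \<open>Zorn's lemma gives a maximal subset without three collinear points. If it is finite,
  maximality puts every further point of \<open>X\<close> on one of the finitely many lines through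
  two of its points.\<close>

lemma finite_lines_or_infinite_no_three_collinear:
  fixes X :: "'v::real_vector set"
  assumes v: "(v::'v) \<noteq> 0"
  obtains A where "A \<subseteq> X" "infinite A" "no_three_collinear A"
  | F where "finite F" "\<forall>(a, d)\<in>F. d \<noteq> 0" "X \<subseteq> (\<Union>(a, d)\<in>F. line a d)"
proof -
  let ?\<A> = "{A. A \<subseteq> X \<and> no_three_collinear A}"
  have "\<exists>A\<in>?\<A>. \<forall>B\<in>?\<A>. A \<subseteq> B \<longrightarrow> B = A"
  proof (rule subset_Zorn')
    fix C assume C: "subset.chain ?\<A> C"
    have "no_three_collinear (\<Union>C)"
      unfolding no_three_collinear_def
    proof (intro ballI impI)
      fix a b c assume abc: "a \<in> \<Union>C" "b \<in> \<Union>C" "c \<in> \<Union>C" "a \<noteq> b" "c \<noteq> a" "c \<noteq> b"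
      obtain A where A: "A \<in> C" "{a, b, c} \<subseteq> A"
        using finite_subset_Union_chain[OF _ _ _ C, of "{a, b, c}"] abc(1-3) by blast
      then have "no_three_collinear A" using C unfolding subset.chain_def by blast
      from no_three_collinearD[OF this A(2) abc(4-6)]
      show "c \<notin> line a (b - a)" .
    qed
    then show "\<Union>C \<in> ?\<A>" using C unfolding subset.chain_def by blast
  qed
  then obtain A where "A \<in> ?\<A>" and max: "\<forall>B\<in>?\<A>. A \<subseteq> B \<longrightarrow> B = A" ..
  then have A: "A \<subseteq> X" "no_three_collinear A" by simp_all
  show ?thesis
  proof (cases "finite A")
    case False
    with A that(1) show ?thesis by blast
  next
    case True
    \<comment> \<open>The lines in direction \<open>v\<close> cover the points of \<open>A\<close>
      themselves, also when \<open>A\<close> is a single point and spans no line.\<close>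
    define F where "F = (\<lambda>a. (a, v)) ` A \<union> (\<lambda>(a, b). (a, b - a)) ` {(a, b). a \<in> A \<and> b \<in> A \<and> a \<noteq> b}"
    have "finite {(a, b). a \<in> A \<and> b \<in> A \<and> a \<noteq> b}"
      by (rule finite_subset[of _ "A \<times> A"]) (use True in auto)
    then have "finite F" using True by (simp add: F_def)
    moreover have "\<forall>(a, d)\<in>F. d \<noteq> 0" using v by (auto simp: F_def)
    moreover have "X \<subseteq> (\<Union>(a, d)\<in>F. line a d)"
    proof
      fix x assume x: "x \<in> X"
      have line_start: "a \<in> line a d" for a d :: 'v
        unfolding line_def by (auto intro: exI[of _ 0])
      \<comment> \<open>A new point can occur as any of the three collinear points; these facts
        allow the line to be drawn through the other two.\<close>
      have line_perm: "z \<in> line a (b - a) \<Longrightarrow> z \<noteq> a \<Longrightarrow> b \<in> line a (z - a)"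
        and line_swap: "z \<in> line a (b - a) \<Longrightarrow> z \<in> line b (a - b)" for a b z :: 'v
      proof -
        assume "z \<in> line a (b - a)"
        then obtain t where t: "z = a + t *\<^sub>R (b - a)" by (auto simp: line_def)
        then have "z = b + (1 - t) *\<^sub>R (a - b)" by (simp add: algebra_simps)
        then show "z \<in> line b (a - b)" by (auto simp: line_def)
        assume "z \<noteq> a"
        with t have "b = a + (1 / t) *\<^sub>R (z - a)" by auto
        then show "b \<in> line a (z - a)" by (auto simp: line_def)
      qed
      show "x \<in> (\<Union>(a, d)\<in>F. line a d)"
      proof (cases "x \<in> A")
        case True
        then show ?thesis using line_start by (auto simp: F_def)
      next
        case False
        then have "\<not> no_three_collinear (insert x A)"
          using bspec[OF max, of "insert x A"] x A(1) by blast
        then obtain a b c where abc: "a \<in> insert x A" "b \<in> insert x A" "c \<in> insert x A"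
          "a \<noteq> b" "c \<noteq> a" "c \<noteq> b" "c \<in> line a (b - a)"
          unfolding no_three_collinear_def by blast
        then consider "x = a" | "x = b" | "x = c"
          using A(2) unfolding no_three_collinear_def by blast
        then have "\<exists>a'\<in>A. \<exists>b'\<in>A. a' \<noteq> b' \<and> x \<in> line a' (b' - a')"
        proof cases
          case 1
          then have "x \<in> line b (c - b)" using line_perm[OF line_swap[OF abc(7)] abc(6)] by simp
          moreover have "b \<in> A" "c \<in> A" "b \<noteq> c" using 1 abc(2-6) by auto
          ultimately show ?thesis by blast
        next
          case 2
          then have "x \<in> line a (c - a)" using line_perm[OF abc(7) abc(5)] by simp
          moreover have "a \<in> A" "c \<in> A" "a \<noteq> c" using 2 abc(1-6) by auto
          ultimately show ?thesis by blast
        next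
          case 3
          with abc show ?thesis by blast
        qed
        then obtain a' b' where ab: "a' \<in> A" "b' \<in> A" "a' \<noteq> b'" "x \<in> line a' (b' - a')"
          by blast
        then have "(a', b' - a') \<in> F" by (auto simp: F_def)
        with ab(4) show ?thesis by (intro UN_I[of "(a', b' - a')"]) simp_all
      qed
    qed
    ultimately show ?thesis using that(2) by blast
  qed
qed

section \<open>The lattice of relatively convex sets\<close>

lemma Co_iff: "A \<in> Co X \<longleftrightarrow> convex hull A \<inter> X = A"
proof
  assume "A \<in> Co X"
  then obtain C where C: "convex C" "A = C \<inter> X" by (auto simp: Co_def)
  then have "convex hull A \<subseteq> C" by (simp add: hull_minimal)
  then show "convex hull A \<inter> X = A" using C(2) hull_subset[of A convex] by blast
next
  assume "convex hull A \<inter> X = A"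
  then show "A \<in> Co X" unfolding Co_def using convex_convex_hull by blast
qed

lemma convex_hull_Int_subset: "A \<in> Co X \<Longrightarrow> F \<subseteq> A \<Longrightarrow> convex hull F \<inter> X \<subseteq> A"
  using hull_mono[of F A convex] unfolding Co_iff by blast

section \<open>Directed unions and compact elements\<close>

text \<open>By directedness, two points in hulls of members lie in the hull of one common member.
  Hence the union of the hulls is convex, and its trace on \<open>X\<close> is
  \<open>\<Union>D\<close>.\<close>

lemma Union_directed_in_Co:
  assumes D: "D \<subseteq> Co X" "directed_sets D"
  shows "\<Union>D \<in> Co X"
proof -
  let ?C = "\<Union>d\<in>D. convex hull d"
  have "convex ?C"
  proof (rule convexI)
    fix x y and u v :: real
    assume xy: "x \<in> ?C" "y \<in> ?C" and uv: "0 \<le> u" "0 \<le> v" "u + v = 1"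
    then obtain d e where "d \<in> D" "x \<in> convex hull d" "e \<in> D" "y \<in> convex hull e" by blast
    moreover from this obtain c where c: "c \<in> D" "d \<subseteq> c" "e \<subseteq> c"
      using D(2) unfolding directed_sets_def by metis
    ultimately have "x \<in> convex hull c" "y \<in> convex hull c"
      using hull_mono by blast+
    then have "u *\<^sub>R x + v *\<^sub>R y \<in> convex hull c"
      using uv convexD[OF convex_convex_hull] by blast
    with c(1) show "u *\<^sub>R x + v *\<^sub>R y \<in> ?C" by blast
  qed
  moreover have "?C \<inter> X = \<Union>D"
    using D(1) unfolding Co_iff subset_iff by blast
  ultimately show ?thesis unfolding Co_def by blast
qed

lemma sup_in_directed:
  assumes "D \<subseteq> Co X" "directed_sets D"
  shows "sup_in (Co X) D = \<Union>D"
  using Union_directed_in_Co[OF assms] unfolding sup_in_def by blast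

lemma finite_subset_directed:
  assumes "finite F" "F \<subseteq> \<Union>D" "directed_sets D"
  shows "\<exists>d\<in>D. F \<subseteq> d"
  using assms(1,2)
proof (induction F rule: finite_induct)
  case empty
  from assms(3) show ?case unfolding directed_sets_def by auto
next
  case (insert x F)
  then obtain d where d: "d \<in> D" "F \<subseteq> d" by auto
  obtain e where e: "e \<in> D" "x \<in> e" using insert.prems by auto
  from d e obtain c where c: "c \<in> D" "d \<subseteq> c" "e \<subseteq> c"
    using assms(3) unfolding directed_sets_def by metis
  with d(2) e(2) show ?case by (intro bexI[OF _ c(1)]) auto
qed

text \<open>Directed suprema are unions, so one member contains the finite set \<open>F\<close>, and
  being closed it contains the closure of \<open>F\<close>.\<close>

lemma convex_hull_Int_compact:
  assumes "finite F" "F \<subseteq> X"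
  shows "convex hull F \<inter> X \<in> compact_elements (Co X)"
  unfolding compact_elements_def
proof (intro CollectI conjI allI impI)
  show "convex hull F \<inter> X \<in> Co X"
    unfolding Co_def using convex_convex_hull by blast
  fix D assume D: "D \<subseteq> Co X \<and> directed_sets D \<and> convex hull F \<inter> X \<subseteq> sup_in (Co X) D"
  then have "F \<subseteq> \<Union>D"
    using sup_in_directed[of D X] hull_subset[of F convex] assms(2) by blast
  then obtain d where "d \<in> D" "F \<subseteq> d"
    using finite_subset_directed[OF assms(1)] D by metis
  then show "\<exists>d\<in>D. convex hull F \<inter> X \<subseteq> d"
    using convex_hull_Int_subset[of d X F] D by blast
qed

lemma compact_elements_subset: "compact_elements L \<subseteq> L"
  by (auto simp: compact_elements_def)

section \<open>Copies of the finite subsets of the naturals and of the rationals\<close>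

text \<open>By convex independence the closure of the points indexed by \<open>N\<close> contains
  \<open>e n\<close> only for \<open>n \<in> N\<close>, so \<open>N\<close> can be recovered from
  it. Closures turn unions of index sets into joins.\<close>

lemma convex_independent_imp_fin_powerset:
  assumes B: "B \<subseteq> X" "infinite B" "convex_independent B"
  shows "has_fin_powerset_subsemilattice (compact_elements (Co X))"
proof -
  obtain e :: "nat \<Rightarrow> 'a" where e: "inj e" "range e \<subseteq> B"
    using infinite_countable_subset[OF B(2)] by blast
  define f where "f N = convex hull (e ` N) \<inter> X" for N
  have eX: "e ` N \<subseteq> X" for N using e(2) B(1) by blast
  have compact: "f N \<in> compact_elements (Co X)" if "finite N" for N
    unfolding f_def using that eX by (intro convex_hull_Int_compact) auto
  have mem: "n \<in> N" if "e n \<in> f N" for n N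
  proof (rule ccontr)
    assume "n \<notin> N"
    then have "e ` N \<subseteq> B - {e n}" using e by (auto dest: injD)
    then have "e n \<in> convex hull (B - {e n})"
      using that hull_mono[of _ _ convex] unfolding f_def by blast
    then show False using B(3) e(2) unfolding convex_independent_def by blast
  qed
  have e_mem: "e ` N \<subseteq> f N" for N
    using eX hull_subset[of "e ` N" convex] unfolding f_def by blast
  have "inj_on f {A. finite A}"
  proof (rule inj_onI)
    fix M N assume "f M = f N"
    then show "M = N" using mem e_mem by blast
  qed
  moreover have "is_lub_in (compact_elements (Co X)) (f M) (f N) (f (M \<union> N))"
    if "finite M" "finite N" for M N
    unfolding is_lub_in_def
  proof (intro conjI ballI impI)
    show "f (M \<union> N) \<in> compact_elements (Co X)" using compact that by simp
    show "f M \<subseteq> f (M \<union> N)" "f N \<subseteq> f (M \<union> N)"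
      unfolding f_def by (auto simp: image_Un intro: subsetD[OF hull_mono, rotated])
    fix d assume d: "d \<in> compact_elements (Co X)" "f M \<subseteq> d \<and> f N \<subseteq> d"
    then have "e ` (M \<union> N) \<subseteq> d" using e_mem by blast
    then show "f (M \<union> N) \<subseteq> d"
      unfolding f_def using convex_hull_Int_subset d(1) compact_elements_subset by blast
  qed
  ultimately show ?thesis
    unfolding has_fin_powerset_subsemilattice_def using compact by blast
qed

text \<open>An arbitrary set of naturals can be sent to the union of the images of its finite
  subsets, and compactness keeps different sets apart. Cuts of the rationals, coded as sets of
  naturals, then give a chain ordered like the rationals.\<close>

lemma fin_powerset_imp_not_order_scattered:
  assumes "has_fin_powerset_subsemilattice (compact_elements (Co X))"
  shows "\<not> order_scattered_sets (Co X)"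
proof -
  obtain f :: "nat set \<Rightarrow> 'a set" where inj: "inj_on f {A. finite A}"
      and "f ` {A. finite A} \<subseteq> compact_elements (Co X)"
      and "\<forall>A B. finite A \<and> finite B \<longrightarrow> is_lub_in (compact_elements (Co X)) (f A) (f B) (f (A \<union> B))"
    using assms unfolding has_fin_powerset_subsemilattice_def by blast
  then have compact: "\<And>A. finite A \<Longrightarrow> f A \<in> compact_elements (Co X)"
    and lub: "\<And>A B. finite A \<Longrightarrow> finite B \<Longrightarrow> is_lub_in (compact_elements (Co X)) (f A) (f B) (f (A \<union> B))"
    by auto
  define below :: "rat \<Rightarrow> nat set" where "below q = {n. from_nat n < q}" for q
  define D where "D q = f ` {A. finite A \<and> A \<subseteq> below q}" for q
  have D_Co: "D q \<subseteq> Co X" for q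
    using compact compact_elements_subset unfolding D_def by blast
  have directed: "directed_sets (D q)" for q
    unfolding directed_sets_def
  proof (intro conjI ballI)
    show "D q \<noteq> {}" unfolding D_def by blast
    fix a b assume "a \<in> D q" "b \<in> D q"
    then obtain A B where AB: "a = f A" "b = f B" "finite A" "finite B" "A \<union> B \<subseteq> below q"
      unfolding D_def by blast
    then have "f (A \<union> B) \<in> D q" unfolding D_def by blast
    then show "\<exists>c\<in>D q. a \<subseteq> c \<and> b \<subseteq> c"
      using lub[OF AB(3,4)] AB(1,2) unfolding is_lub_in_def by blast
  qed
  have strict: "\<Union>(D p) \<subset> \<Union>(D q)" if "p < q" for p q
  proof
    show "\<Union>(D p) \<subseteq> \<Union>(D q)" using that unfolding D_def below_def by fastforce
    \<comment> \<open>\<open>n\<close> codes \<open>p\<close> itself, which belongs to the cut at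
      \<open>q\<close> but not to the cut at \<open>p\<close>.\<close>
    define n where "n = to_nat p"
    have n: "n \<in> below q" "n \<notin> below p" using that by (simp_all add: n_def below_def)
    show "\<Union>(D p) \<noteq> \<Union>(D q)"
    proof
      assume "\<Union>(D p) = \<Union>(D q)"
      moreover have "f {n} \<in> D q" using n(1) unfolding D_def by blast
      ultimately have "f {n} \<subseteq> sup_in (Co X) (D p)"
        using sup_in_directed[OF D_Co directed, of p] by blast
      with compact[of "{n}"] D_Co directed obtain d where "d \<in> D p" "f {n} \<subseteq> d"
        unfolding compact_elements_def by blast
      then obtain A where A: "finite A" "A \<subseteq> below p" "f {n} \<subseteq> f A" unfolding D_def by blast
      \<comment> \<open>\<open>f A\<close> is now an upper bound of \<open>f A\<close> and
        \<open>f {n}\<close>, hence equal to their join.\<close>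
      then have "f (A \<union> {n}) = f A"
        using lub[of A "{n}"] compact[of A] unfolding is_lub_in_def by blast
      then have "A \<union> {n} = A" using inj_onD[OF inj] A(1) by simp
      with A(2) n(2) show False by blast
    qed
  qed
  have "range (\<lambda>q. \<Union>(D q)) \<subseteq> Co X"
    using Union_directed_in_Co[OF D_Co directed] by blast
  with strict show ?thesis
    unfolding order_scattered_sets_def not_not by (intro exI[of _ "\<lambda>q. \<Union>(D q)"]) simp
qed

text \<open>For a copy \<open>f\<close> of the rationals in \<open>Co X\<close>, the sets \<open>\<Union>q<r. f q\<close> form a family without
  isolated points.\<close>
lemma isolated_imp_order_scattered:
  assumes iso: "\<And>Y. Y \<subseteq> Co X \<Longrightarrow> Y \<noteq> {} \<Longrightarrow>
      \<exists>A\<in>Y. \<exists>E. finite E \<and> E \<subseteq> X \<and> (\<forall>B\<in>Y. B \<inter> E = A \<inter> E \<longrightarrow> B = A)"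
  shows "order_scattered_sets (Co X)"
  unfolding order_scattered_sets_def
proof
  assume "\<exists>f::rat \<Rightarrow> 'a set. range f \<subseteq> Co X \<and> (\<forall>p q. p < q \<longrightarrow> f p \<subset> f q)"
  then obtain f :: "rat \<Rightarrow> 'a set" where f: "range f \<subseteq> Co X" and mono: "\<And>p q. p < q \<Longrightarrow> f p \<subset> f q"
    by blast
  \<comment> \<open>Each \<open>g r\<close> is a directed union of earlier sets, so a single
    \<open>f q\<close> with \<open>q < r\<close> already contains its trace on a finite set.\<close>
  define g where "g r = \<Union>(f ` {..<r})" for r
  have directed: "directed_sets (f ` {..<r})" for r
    unfolding directed_sets_def
  proof (intro conjI ballI)
    show "f ` {..<r} \<noteq> {}" using lt_ex[of r] by auto
    fix a b assume "a \<in> f ` {..<r}" "b \<in> f ` {..<r}"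
    then obtain p q where pq: "a = f p" "b = f q" "p < r" "q < r" by blast
    have "f p \<subseteq> f (max p q)" "f q \<subseteq> f (max p q)"
      using mono[of p q] mono[of q p] by (cases p q rule: linorder_cases; auto simp: max_def)+
    with pq show "\<exists>c\<in>f ` {..<r}. a \<subseteq> c \<and> b \<subseteq> c"
      by (intro bexI[of _ "f (max p q)"]) auto
  qed
  have "g r \<in> Co X" for r
    unfolding g_def using f by (intro Union_directed_in_Co directed) auto
  then have "range g \<subseteq> Co X" "range g \<noteq> {}" by auto
  from iso[OF this] obtain r E where E: "finite E" "\<And>s. g s \<inter> E = g r \<inter> E \<Longrightarrow> g s = g r"
    by auto
  have "finite (g r \<inter> E)" "g r \<inter> E \<subseteq> \<Union>(f ` {..<r})"
    using E(1) by (auto simp: g_def)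
  from finite_subset_directed[OF this directed] obtain q where q: "q < r" "g r \<inter> E \<subseteq> f q"
    by blast
  obtain s where s: "q < s" "s < r" using dense[OF q(1)] by blast
  \<comment> \<open>A second intermediate rational secures strictness, as
    \<open>g s \<subseteq> f s \<subset> f s' \<subseteq> g r\<close>.\<close>
  obtain s' where s': "s < s'" "s' < r" using dense[OF s(2)] by blast
  have "f q \<subseteq> g s" "g s \<subseteq> g r" using s by (force simp: g_def)+
  then have "g s = g r" using E(2)[of s] q(2) by blast
  moreover have "g s \<subseteq> f s" using mono unfolding g_def by blast
  moreover have "f s \<subset> f s'" "f s' \<subseteq> g r" using mono[OF s'(1)] s'(2) by (auto simp: g_def)
  ultimately show False by blast
qed

text \<open>Segments from a fixed point of the chain to later and later points have strictly growing
  traces on \<open>X\<close>, and each trace is compact because two points generate it.\<close>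

lemma not_order_scattered_line:
  assumes "\<not> order_scattered_real {t. a + t *\<^sub>R d \<in> X}" "d \<noteq> 0"
  shows "\<not> order_scattered_sets (compact_elements (Co X))"
proof -
  obtain f :: "rat \<Rightarrow> real" where f: "\<And>q. a + f q *\<^sub>R d \<in> X" and mono: "\<And>p q. p < q \<Longrightarrow> f p < f q"
    using assms(1) unfolding order_scattered_real_def by blast
  \<comment> \<open>A strictly increasing map of the rationals into the positive rationals, so that
    all segments leave \<open>pt 0\<close> in the same direction.\<close>
  define pos :: "rat \<Rightarrow> rat" where "pos q = (if 0 \<le> q then 1 + q else 1 / (1 - q))" for q
  have pos: "0 < pos q" for q by (simp add: pos_def)
  have pos_mono: "pos p < pos q" if "p < q" for p q
  proof -
    have "1 / (1 - p) < 1 / (1 - q)" if "q < 0"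
      using that \<open>p < q\<close> by (intro divide_strict_left_mono) auto
    moreover have "1 / (1 - p) < 1 + q" if "p < 0" "0 \<le> q"
    proof -
      have "1 / (1 - p) < 1" using that by simp
      with that(2) show ?thesis by linarith
    qed
    ultimately show ?thesis using that by (auto simp: pos_def)
  qed
  define pt where "pt q = a + f q *\<^sub>R d" for q
  define g where "g q = convex hull {pt 0, pt (pos q)} \<inter> X" for q
  have g_iff: "pt r \<in> g q \<longleftrightarrow> r \<le> pos q" if "0 \<le> r" for r q
  proof -
    let ?s = "pos q"
    have "f 0 < f ?s" using mono pos by blast
    have "pt r \<in> convex hull {pt 0, pt ?s} \<longleftrightarrow> r \<le> ?s"
    proof
      assume "pt r \<in> convex hull {pt 0, pt ?s}"
      then obtain u where u: "0 \<le> u" "u \<le> 1" "pt r = (1 - u) *\<^sub>R pt 0 + u *\<^sub>R pt ?s"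
        by (auto simp: in_segment simp flip: segment_convex_hull)
      then have "(f r - (f 0 + u * (f ?s - f 0))) *\<^sub>R d = 0"
        by (simp add: pt_def algebra_simps)
      then have "f r = f 0 + u * (f ?s - f 0)" using assms(2) by simp
      moreover have "u * (f ?s - f 0) \<le> 1 * (f ?s - f 0)"
        using u(2) \<open>f 0 < f ?s\<close> by (intro mult_right_mono) auto
      ultimately have "f r \<le> f ?s" by simp
      then show "r \<le> ?s" using mono[of ?s r] by linarith
    next
      assume "r \<le> ?s"
      then have le: "f r \<le> f ?s" "f 0 \<le> f r"
        using mono[of r ?s] mono[of 0 r] that by (auto simp: order_le_less)
      define u where "u = (f r - f 0) / (f ?s - f 0)"
      have "0 \<le> u" "u \<le> 1" and fr: "f r = f 0 + u * (f ?s - f 0)"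
        using le \<open>f 0 < f ?s\<close> by (simp_all add: u_def)
      moreover have "pt r = (1 - u) *\<^sub>R pt 0 + u *\<^sub>R pt ?s"
        unfolding pt_def fr by (simp add: algebra_simps)
      ultimately show "pt r \<in> convex hull {pt 0, pt ?s}"
        by (auto simp: in_segment simp flip: segment_convex_hull)
    qed
    then show ?thesis using f by (simp add: g_def pt_def)
  qed
  have "g p \<subset> g q" if "p < q" for p q
  proof
    have "{pt 0, pt (pos p)} \<subseteq> convex hull {pt 0, pt (pos q)}"
      using g_iff[of 0 q] g_iff[of "pos p" q] pos[of p] pos[of q] pos_mono[OF that] by (simp add: g_def)
    then have "convex hull {pt 0, pt (pos p)} \<subseteq> convex hull {pt 0, pt (pos q)}"
      by (simp add: hull_minimal)
    then show "g p \<subseteq> g q" by (auto simp: g_def)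
    have "pt (pos q) \<in> g q" "pt (pos q) \<notin> g p"
      using g_iff pos[of q] pos_mono[OF that] by auto
    then show "g p \<noteq> g q" by blast
  qed
  moreover have "g q \<in> compact_elements (Co X)" for q
    unfolding g_def using f by (intro convex_hull_Int_compact) (auto simp: pt_def)
  ultimately show ?thesis unfolding order_scattered_sets_def by blast
qed

section \<open>Isolated members, one line at a time\<close>

text \<open>Every member contains the origin \<open>a\<close> of the ray, so convexity makes its
  trace a down-set of parameters and \<open>isolated_downset\<close> applies. What is determined is
  the trace on the ray, not yet the whole set.\<close>

lemma isolate_on_ray:
  assumes Y: "Y \<subseteq> Co X" "Y \<noteq> {}" and a: "\<forall>B\<in>Y. a \<in> B"
    and scattered: "order_scattered_real {t. a + t *\<^sub>R d \<in> X}"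
  shows "\<exists>A\<in>Y. \<exists>E. finite E \<and> E \<subseteq> X \<and>
    (\<forall>B\<in>Y. B \<inter> E = A \<inter> E \<longrightarrow> (\<forall>t\<ge>0. a + t *\<^sub>R d \<in> B \<longleftrightarrow> a + t *\<^sub>R d \<in> A))"
proof -
  define T where "T = {t. 0 \<le> t \<and> a + t *\<^sub>R d \<in> X}"
  define ray where "ray B = {t. 0 \<le> t \<and> a + t *\<^sub>R d \<in> B}" for B
  have "order_scattered_real T"
    using scattered unfolding T_def order_scattered_real_def by blast
  moreover have "ray ` Y \<noteq> {}" using Y(2) by blast
  moreover have "D \<subseteq> T \<and> (\<forall>s\<in>T. \<forall>t\<in>D. s \<le> t \<longrightarrow> s \<in> D)" if "D \<in> ray ` Y" for D
  proof (intro conjI ballI impI)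
    obtain B where B: "D = ray B" "B \<in> Y" using \<open>D \<in> ray ` Y\<close> by blast
    then have hull: "convex hull B \<inter> X = B" using Y(1) Co_iff by blast
    then show "D \<subseteq> T" unfolding B(1) ray_def T_def by blast
    fix s t assume st: "s \<in> T" "t \<in> D" "s \<le> t"
    show "s \<in> D"
    proof (cases "t = 0")
      case True
      then show ?thesis using st by (simp add: T_def)
    next
      case False
      then have t: "0 < t" "0 \<le> s" "s / t \<le> 1" using st by (auto simp: T_def)
      have "a + t *\<^sub>R d \<in> convex hull B" "a \<in> convex hull B"
        using st(2) bspec[OF a B(2)] hull_subset[of B convex] by (auto simp: B(1) ray_def)
      \<comment> \<open>The point with parameter \<open>s\<close> lies on the segment from
        \<open>a\<close> to the point with parameter \<open>t\<close>.\<close>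
      then have "(1 - s / t) *\<^sub>R a + (s / t) *\<^sub>R (a + t *\<^sub>R d) \<in> convex hull B"
        using t by (intro convexD_alt convex_convex_hull) auto
      also have "(1 - s / t) *\<^sub>R a + (s / t) *\<^sub>R (a + t *\<^sub>R d) = a + s *\<^sub>R d"
        using t by (simp add: algebra_simps)
      finally show ?thesis using hull st(1) by (auto simp: B(1) ray_def T_def)
    qed
  qed
  ultimately have "\<exists>D\<in>ray ` Y. \<exists>E. finite E \<and> E \<subseteq> T \<and> (\<forall>D'\<in>ray ` Y. D' \<inter> E = D \<inter> E \<longrightarrow> D' = D)"
    by (rule isolated_downset)
  then obtain A E where A: "A \<in> Y" "finite E" "E \<subseteq> T"
    and "\<forall>D'\<in>ray ` Y. D' \<inter> E = ray A \<inter> E \<longrightarrow> D' = ray A"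
    by (elim bexE exE conjE imageE) simp
  then have iso: "B \<in> Y \<Longrightarrow> ray B \<inter> E = ray A \<inter> E \<Longrightarrow> ray B = ray A" for B
    by simp
  let ?E = "(\<lambda>t. a + t *\<^sub>R d) ` E"
  have "\<forall>t\<ge>0. a + t *\<^sub>R d \<in> B \<longleftrightarrow> a + t *\<^sub>R d \<in> A" if "B \<in> Y" "B \<inter> ?E = A \<inter> ?E" for B
  proof -
    have "ray B \<inter> E = ray A \<inter> E"
      using that(2) unfolding ray_def by blast
    from iso[OF that(1) this] show ?thesis unfolding ray_def by blast
  qed
  moreover have "finite ?E" "?E \<subseteq> X" using A(2,3) by (auto simp: T_def)
  ultimately show ?thesis
    by (intro bexI[OF _ A(1)] exI[of _ ?E] conjI ballI impI) simp_all
qed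

text \<open>A point \<open>b\<close> of some trace cuts the line into two rays. Among the members
  containing \<open>b\<close>, one is isolated on the first ray; among those that agree with it on
  \<open>E1\<close>, and so along that ray, one is isolated on the opposite ray.\<close>

lemma isolate_on_line:
  assumes Y: "Y \<subseteq> Co X" "Y \<noteq> {}" and scattered: "order_scattered_real {t. a + t *\<^sub>R d \<in> X}"
  shows "\<exists>A\<in>Y. \<exists>E. finite E \<and> E \<subseteq> X \<and>
    (\<forall>B\<in>Y. B \<inter> E = A \<inter> E \<longrightarrow> B \<inter> line a d = A \<inter> line a d)"
proof (cases "\<forall>B\<in>Y. B \<inter> line a d = {}")
  \<comment> \<open>If no member meets the line, any member works with the empty test set.\<close>
  case True
  with Y(2) show ?thesis by (metis all_not_in_conv empty_subsetI finite.emptyI)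
next
  case False
  then obtain B0 t0 where B0: "B0 \<in> Y" "a + t0 *\<^sub>R d \<in> B0" by (auto simp: line_def)
  define b where "b = a + t0 *\<^sub>R d"
  have pos: "order_scattered_real {t. b + t *\<^sub>R d \<in> X}"
    unfolding order_scattered_real_def
  proof (rule notI, elim exE conjE)
    fix f :: "rat \<Rightarrow> real"
    assume f: "range f \<subseteq> {t. b + t *\<^sub>R d \<in> X}" "\<forall>p q. p < q \<longrightarrow> f p < f q"
    then have "range (\<lambda>q. t0 + f q) \<subseteq> {t. a + t *\<^sub>R d \<in> X}"
      by (auto simp: b_def algebra_simps)
    with f(2) scattered show False
      unfolding order_scattered_real_def by (metis add_strict_left_mono)
  qed
  have neg: "order_scattered_real {t. b + t *\<^sub>R (- d) \<in> X}"
    unfolding order_scattered_real_def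
  proof (rule notI, elim exE conjE)
    fix f :: "rat \<Rightarrow> real"
    assume f: "range f \<subseteq> {t. b + t *\<^sub>R (- d) \<in> X}" "\<forall>p q. p < q \<longrightarrow> f p < f q"
    \<comment> \<open>Reversing the direction reverses the order of the parameters; replacing
      \<open>q\<close> by \<open>- q\<close> restores it.\<close>
    then have "range (\<lambda>q. t0 - f (- q)) \<subseteq> {t. a + t *\<^sub>R d \<in> X}"
      by (fastforce simp: b_def algebra_simps)
    moreover have "\<forall>p q. p < q \<longrightarrow> t0 - f (- p) < t0 - f (- q)" using f(2) by simp
    ultimately show False
      using scattered unfolding order_scattered_real_def by blast
  qed
  define Y1 where "Y1 = {B\<in>Y. b \<in> B}"
  have Y1: "Y1 \<subseteq> Co X" "Y1 \<noteq> {}" "\<forall>B\<in>Y1. b \<in> B"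
    using Y(1) B0 by (auto simp: Y1_def b_def)
  from isolate_on_ray[OF this pos]
  obtain A1 E1 where A1: "A1 \<in> Y1" "finite E1" "E1 \<subseteq> X"
    and all1: "\<forall>B\<in>Y1. B \<inter> E1 = A1 \<inter> E1 \<longrightarrow> (\<forall>t\<ge>0. b + t *\<^sub>R d \<in> B \<longleftrightarrow> b + t *\<^sub>R d \<in> A1)"
    by (elim bexE exE conjE)
  have iso1: "b + t *\<^sub>R d \<in> B \<longleftrightarrow> b + t *\<^sub>R d \<in> A1"
    if "B \<in> Y1" "B \<inter> E1 = A1 \<inter> E1" "0 \<le> t" for B t
    using mp[OF bspec[OF all1 that(1)] that(2)] that(3) by simp
  define Y2 where "Y2 = {B\<in>Y1. B \<inter> E1 = A1 \<inter> E1}"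
  have "Y2 \<subseteq> Co X" "Y2 \<noteq> {}" "\<forall>B\<in>Y2. b \<in> B"
    using Y1 A1(1) by (auto simp: Y2_def)
  from isolate_on_ray[OF this neg]
  obtain A2 E2 where A2: "A2 \<in> Y2" "finite E2" "E2 \<subseteq> X"
    and all2: "\<forall>B\<in>Y2. B \<inter> E2 = A2 \<inter> E2 \<longrightarrow> (\<forall>t\<ge>0. b + t *\<^sub>R (- d) \<in> B \<longleftrightarrow> b + t *\<^sub>R (- d) \<in> A2)"
    by (elim bexE exE conjE)
  have iso2: "b + t *\<^sub>R (- d) \<in> B \<longleftrightarrow> b + t *\<^sub>R (- d) \<in> A2"
    if "B \<in> Y2" "B \<inter> E2 = A2 \<inter> E2" "0 \<le> t" for B t
    using mp[OF bspec[OF all2 that(1)] that(2)] that(3) by simp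
  \<comment> \<open>With \<open>b\<close> in the test set, every member agreeing with
    \<open>A2\<close> on \<open>E\<close> contains \<open>b\<close>, as both ray arguments
    require.\<close>
  define E where "E = insert b (E1 \<union> E2)"
  have "b \<in> X" using B0 Y(1) Co_iff unfolding b_def by blast
  then have "finite E" "E \<subseteq> X" using A1 A2 by (auto simp: E_def)
  moreover have "A2 \<in> Y" using A2(1) by (simp add: Y2_def Y1_def)
  moreover have "B \<inter> line a d = A2 \<inter> line a d" if B: "B \<in> Y" "B \<inter> E = A2 \<inter> E" for B
  proof -
    have A2': "b \<in> A2" "A2 \<in> Y1" "A2 \<inter> E1 = A1 \<inter> E1" using A2(1) by (auto simp: Y2_def Y1_def)
    have "b \<in> B" using B(2) A2'(1) unfolding E_def by blast
    then have B1: "B \<in> Y1" using B(1) by (simp add: Y1_def)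
    have "B \<inter> E1 = A2 \<inter> E1" "B \<inter> E2 = A2 \<inter> E2" using B(2) unfolding E_def by blast+
    with A2'(3) have BE: "B \<inter> E1 = A1 \<inter> E1" "B \<inter> E2 = A2 \<inter> E2" by simp_all
    with B1 have B2: "B \<in> Y2" by (simp add: Y2_def)
    have "b + t *\<^sub>R d \<in> B \<longleftrightarrow> b + t *\<^sub>R d \<in> A2" for t
    proof (cases "0 \<le> t")
      case True
      then show ?thesis using iso1[OF B1 BE(1)] iso1[OF A2'(2,3)] by simp
    next
      case False
      then show ?thesis using iso2[OF B2 BE(2), of "- t"] by simp
    qed
    moreover have "a + t *\<^sub>R d = b + (t - t0) *\<^sub>R d" for t
      by (simp add: b_def algebra_simps)
    ultimately have "a + t *\<^sub>R d \<in> B \<longleftrightarrow> a + t *\<^sub>R d \<in> A2" for t by metis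
    then show ?thesis by (auto simp: line_def)
  qed
  ultimately show ?thesis
    by (intro bexI[of _ A2] exI[of _ E] conjI ballI impI)
qed

text \<open>By induction on the lines: the family is cut down to the members with the same trace on
  \<open>E\<close> as \<open>A\<close>, which already agree on the earlier lines, and within it some
  \<open>A'\<close> is isolated on the next line. Then \<open>E \<union> E'\<close> tests all of
  them.\<close>

lemma isolate_on_lines:
  assumes "finite F" "\<forall>(a, d)\<in>F. order_scattered_real {t. a + t *\<^sub>R d \<in> X}"
    and Y: "Y \<subseteq> Co X" "Y \<noteq> {}"
  shows "\<exists>A\<in>Y. \<exists>E. finite E \<and> E \<subseteq> X \<and>
    (\<forall>B\<in>Y. B \<inter> E = A \<inter> E \<longrightarrow> (\<forall>(a, d)\<in>F. B \<inter> line a d = A \<inter> line a d))"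
  using assms(1,2)
proof (induction F rule: finite_induct)
  case empty
  then show ?case using Y(2) by auto
next
  case (insert l F)
  obtain a d where l: "l = (a, d)" by fastforce
  have "\<exists>A\<in>Y. \<exists>E. finite E \<and> E \<subseteq> X \<and>
    (\<forall>B\<in>Y. B \<inter> E = A \<inter> E \<longrightarrow> (\<forall>(a, d)\<in>F. B \<inter> line a d = A \<inter> line a d))"
    by (rule insert.IH) (use insert.prems in simp)
  then obtain A E where A: "A \<in> Y" "finite E" "E \<subseteq> X"
    and iso0: "\<forall>B\<in>Y. B \<inter> E = A \<inter> E \<longrightarrow> (\<forall>(a, d)\<in>F. B \<inter> line a d = A \<inter> line a d)"
    by (elim bexE exE conjE)
  have iso: "\<forall>(a, d)\<in>F. B \<inter> line a d = A \<inter> line a d" if "B \<in> Y" "B \<inter> E = A \<inter> E" for B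
    using bspec[OF iso0 that(1)] that(2) by (rule mp)
  define Y' where "Y' = {B\<in>Y. B \<inter> E = A \<inter> E}"
  have "Y' \<subseteq> Co X" "Y' \<noteq> {}" "order_scattered_real {t. a + t *\<^sub>R d \<in> X}"
    using Y(1) A(1) insert.prems by (auto simp: Y'_def l)
  from isolate_on_line[OF this]
  obtain A' E' where A': "A' \<in> Y'" "finite E'" "E' \<subseteq> X"
    and iso'': "\<forall>B\<in>Y'. B \<inter> E' = A' \<inter> E' \<longrightarrow> B \<inter> line a d = A' \<inter> line a d"
    by (elim bexE exE conjE)
  have iso': "B \<inter> line a d = A' \<inter> line a d" if "B \<in> Y'" "B \<inter> E' = A' \<inter> E'" for B
    using bspec[OF iso'' that(1)] that(2) by (rule mp)
  have A'Y: "A' \<in> Y" "A' \<inter> E = A \<inter> E" using A'(1) by (auto simp: Y'_def)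
  have const: "\<forall>(a, d)\<in>insert l F. B \<inter> line a d = A' \<inter> line a d"
    if B: "B \<in> Y" "B \<inter> (E \<union> E') = A' \<inter> (E \<union> E')" for B
  proof -
    have "B \<inter> E = A' \<inter> E" and E': "B \<inter> E' = A' \<inter> E'" using B(2) by blast+
    with A'Y have BE: "B \<inter> E = A \<inter> E" by simp
    with B(1) have "B \<in> Y'" by (simp add: Y'_def)
    note new = iso'[OF this E']
    have "B \<inter> line a' d' = A' \<inter> line a' d'" if "(a', d') \<in> F" for a' d'
      using bspec[OF iso[OF B(1) BE] that] bspec[OF iso[OF A'Y] that] by simp
    with new show ?thesis unfolding l by auto
  qed
  have "\<forall>B\<in>Y. B \<inter> (E \<union> E') = A' \<inter> (E \<union> E') \<longrightarrow> (\<forall>(a, d)\<in>insert l F. B \<inter> line a d = A' \<inter> line a d)"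
    by (rule ballI, rule impI, rule const)
  moreover have "finite (E \<union> E')" "E \<union> E' \<subseteq> X" using A A' by auto
  ultimately show ?case
    by (intro bexI[OF _ A'Y(1)] exI[of _ "E \<union> E'"] conjI)
qed

text \<open>A subset of \<open>X\<close> is determined by its traces on lines covering
  \<open>X\<close>, so agreement on all lines is equality.\<close>

lemma scattered_lines_imp_isolated:
  assumes F: "finite F" "X \<subseteq> (\<Union>(a, d)\<in>F. line a d)"
      "\<forall>(a, d)\<in>F. order_scattered_real {t. a + t *\<^sub>R d \<in> X}"
    and Y: "Y \<subseteq> Co X" "Y \<noteq> {}"
  shows "\<exists>A\<in>Y. \<exists>E. finite E \<and> E \<subseteq> X \<and> (\<forall>B\<in>Y. B \<inter> E = A \<inter> E \<longrightarrow> B = A)"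
proof -
  have eq: "B = A" if AB: "\<forall>(a, d)\<in>F. B \<inter> line a d = A \<inter> line a d" "A \<in> Y" "B \<in> Y" for A B
  proof -
    have "x \<in> B \<longleftrightarrow> x \<in> A" if x: "x \<in> X" for x
    proof -
      obtain a d where "(a, d) \<in> F" "x \<in> line a d" using F(2) x by auto
      moreover from this have "B \<inter> line a d = A \<inter> line a d" using AB(1) by auto
      ultimately show ?thesis by blast
    qed
    moreover have "A \<subseteq> X" "B \<subseteq> X" using AB(2,3) Y(1) by (auto simp: Co_def)
    ultimately show ?thesis by blast
  qed
  from isolate_on_lines[OF F(1,3) Y]
  obtain A E where A: "A \<in> Y" "finite E" "E \<subseteq> X"
    and iso: "\<forall>B\<in>Y. B \<inter> E = A \<inter> E \<longrightarrow> (\<forall>(a, d)\<in>F. B \<inter> line a d = A \<inter> line a d)"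
    by (elim bexE exE conjE)
  have "B = A" if "B \<in> Y" "B \<inter> E = A \<inter> E" for B
    using eq[OF mp[OF bspec[OF iso that(1)] that(2)] A(1) that(1)] .
  with A show ?thesis
    by (intro bexI[OF _ A(1)] exI[of _ E] conjI ballI impI)
qed

section \<open>The cycle of implications\<close>

text \<open>The parameter \<open>t\<close> orients each line. \<open>nontriv\<close> ensures that
  lines exist: in the zero space a one-point \<open>X\<close> meets the first three conditions, but
  no pair has a nonzero direction.\<close>

theorem theorem5p1:
  fixes X :: "'v::real_vector set"
  assumes nontriv: "\<exists>v::'v. v \<noteq> 0"
  shows
   "(top_scattered (subtopology (cantor_cube X) (char_fun X ` Co X))
       \<longleftrightarrow> order_scattered_sets (Co X))
  \<and> (order_scattered_sets (Co X)
       \<longleftrightarrow> (order_scattered_sets (compact_elements (Co X))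
            \<and> \<not> has_fin_powerset_subsemilattice (compact_elements (Co X))))
  \<and> (order_scattered_sets (Co X)
       \<longleftrightarrow> (\<exists>F :: ('v \<times> 'v) set. finite F \<and> (\<forall>(a, d)\<in>F. d \<noteq> 0)
              \<and> X \<subseteq> (\<Union>(a, d)\<in>F. line a d)
              \<and> (\<forall>(a, d)\<in>F. order_scattered_real {t. a + t *\<^sub>R d \<in> X})))"
    (is "(?i \<longleftrightarrow> ?ii) \<and> (?ii \<longleftrightarrow> ?iii) \<and> (?ii \<longleftrightarrow> ?iv)")
proof -
  have "Co X \<subseteq> Pow X" by (auto simp: Co_def)
  note isolated = top_scattered_iff[OF this]
  have "?i \<Longrightarrow> ?ii"
    unfolding isolated by (rule isolated_imp_order_scattered) blast
  moreover have "?ii \<Longrightarrow> ?iii"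
    using fin_powerset_imp_not_order_scattered compact_elements_subset[of "Co X"]
    unfolding order_scattered_sets_def by blast
  moreover have "?iii \<Longrightarrow> ?iv"
  proof -
    assume iii: ?iii
    obtain v :: 'v where v: "v \<noteq> 0" using nontriv by blast
    from v show ?iv
    proof (cases rule: finite_lines_or_infinite_no_three_collinear[of v X])
      \<comment> \<open>An infinite set without three collinear points would produce the excluded
        copy of the finite subsets of the naturals.\<close>
      case (1 A)
      obtain B where "B \<subseteq> A" "infinite B" "convex_independent B"
        by (rule infinite_convex_independent_subset[OF 1(2,3)])
      then have "has_fin_powerset_subsemilattice (compact_elements (Co X))"
        using 1(1) by (intro convex_independent_imp_fin_powerset[of B]) auto
      with iii show ?thesis by blast
    next
      \<comment> \<open>A covering line that is not scattered would put a copy of the rationals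
        among the compact elements.\<close>
      case (2 F)
      have "\<forall>(a, d)\<in>F. order_scattered_real {t. a + t *\<^sub>R d \<in> X}"
        using 2(2) iii not_order_scattered_line[of _ _ X] by auto
      with 2 show ?thesis by (intro exI[of _ F] conjI)
    qed
  qed
  moreover have "?iv \<Longrightarrow> ?i"
    unfolding isolated by (elim exE conjE, intro allI impI) (rule scattered_lines_imp_isolated)
  ultimately show ?thesis by blast
qed

end
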